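(* Fix an integer $k\ge 1$. For $q\in\mathbb N$ let $\mathrm{Kn}(q,k)$ be the Kneser graph, and let $f_q(n)=\chi_{\mathrm{Kn}(q,k)}(n)$ be its chromatic polynomial. Then $f_q(n)$ is a two-level polynomial of degree function $\binom{q}{k}$ and infinite depth.
   Context: $\mathbb N=\{0,1,2,\dots\}$. The Kneser graph $\mathrm{Kn}(q,k)$ has as vertices the $k$-element subsets of $[q]=\{1,\dots,q\}$, two vertices being adjacent exactly when they are disjoint. The chromatic polynomial $\chi_G(n)$ counts colorings of the vertices of $G$ with $n$ colors such that adjacent vertices get different colors (it is $1$ for the graph with no vertices). A numerical polynomial is $g\in\mathbb Q[x]$ with $g(q)\in\mathbb Z$ for all $q\in\mathbb Z$. Two-level polynomial: let $g$ be an eventually nonnegative numerical polynomial, $S=\{q\in\mathbb N: g(q)\ge0\}$, $e:S\to\mathbb N\cup\{-1,\infty\}$. A two-level polynomial of degree function $g$ and depth function $e$ is a sequence of polynomials $\{f_q\}_{q\in S}$, $f_q(n)$ of degree $g(q)$, such that, writing $f_q(n)=\sum_{r\ge0}c_r(q)n^{g(q)-r}$ with $c_r(q)=0$ for $r>g(q)$, there exist polynomials $\{\phi_r(q)\}_{r\ge0}$ with $c_r(q)=\phi_r(q)$ for every $q\in S$ and every $r\le e(q)$. Infinite depth means $e(q)=\infty$ for all $q\in S$, i.e. the equality holds for all $r\ge 0$ (including $r>g(q)$, where $\phi_r(q)=0$). *)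

theory Defs
  imports
    "HOL-Computational_Algebra.Polynomial"
    "HOL-Library.FuncSet"
    "HOL-Library.Extended"
begin

text \<open>A graph is a pair of its vertex set and its set of edges, each edge being the set of its two
  end points.\<close>

type_synonym 'v graph = "'v set \<times> 'v set set"

definition kneser_graph :: "nat \<Rightarrow> nat \<Rightarrow> nat set graph" where
  "kneser_graph q k =
     (let V = {A. A \<subseteq> {1..q} \<and> card A = k}
      in (V, {{A, B} | A B. A \<in> V \<and> B \<in> V \<and> A \<inter> B = {}}))"

definition proper_colorings :: "'v graph \<Rightarrow> nat \<Rightarrow> ('v \<Rightarrow> nat) set" where
  "proper_colorings G n =
     {c \<in> fst G \<rightarrow>\<^sub>E {1..n}. \<forall>u\<in>fst G. \<forall>v\<in>fst G. {u, v} \<in> snd G \<longrightarrow> c u \<noteq> c v}"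

text \<open>The description is proper whenever the vertex set is finite, see
  \<open>poly_chromatic_polynomial\<close> below.\<close>

definition chromatic_polynomial :: "'v graph \<Rightarrow> rat poly" where
  "chromatic_polynomial G =
     (THE p. \<forall>n::nat. poly p (of_nat n) = of_nat (card (proper_colorings G n)))"

definition numerical_polynomial :: "rat poly \<Rightarrow> bool" where
  "numerical_polynomial g \<longleftrightarrow> (\<forall>q::int. poly g (of_int q) \<in> \<int>)"

text \<open>Only the values of \<open>e\<close> and \<open>f\<close> on \<open>{q. 0 \<le> poly g (of_nat q)}\<close> matter. The
  requirement \<open>Fin (-1) \<le> e q\<close> says that \<open>e q\<close> is a natural number, \<open>-1\<close> or
  infinity. The condition \<open>f q \<noteq> 0\<close> is needed because the zero polynomial has
  \<open>degree\<close> \<open>0\<close> by convention.\<close>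

definition two_level_polynomial ::
    "rat poly \<Rightarrow> (nat \<Rightarrow> int extended) \<Rightarrow> (nat \<Rightarrow> rat poly) \<Rightarrow> bool" where
  "two_level_polynomial g e f \<longleftrightarrow>
     numerical_polynomial g \<and>
     (\<forall>\<^sub>F q::nat in sequentially. 0 \<le> poly g (of_nat q)) \<and>
     (let S = {q::nat. 0 \<le> poly g (of_nat q)};
          c = (\<lambda>r q. if r \<le> degree (f q) then coeff (f q) (degree (f q) - r) else 0)
      in (\<forall>q\<in>S. Fin (-1) \<le> e q) \<and>
         (\<forall>q\<in>S. f q \<noteq> 0 \<and> of_nat (degree (f q)) = poly g (of_nat q)) \<and>
         (\<exists>\<phi> :: nat \<Rightarrow> rat poly. \<forall>q\<in>S. \<forall>r::nat.
            Fin (int r) \<le> e q \<longrightarrow> c r q = poly (\<phi> r) (of_nat q)))"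

definition binomial_poly :: "nat \<Rightarrow> rat poly" where
  "binomial_poly k = smult (1 / fact k) (\<Prod>i<k. [:- of_nat i, 1:])"

lemma poly_binomial_poly: "poly (binomial_poly k) x = x gchoose k"
  by (simp add: binomial_poly_def poly_prod gbinomial_prod_rev atLeast0LessThan)

lemma poly_binomial_poly_of_nat: "poly (binomial_poly k) (of_nat q) = of_nat (q choose k)"
  by (simp add: poly_binomial_poly binomial_gbinomial)

lemma surjective_proper_colorings_card_eq:
  fixes A B :: "nat set"
  assumes "bij_betw h A B"
  shows "card {c \<in> V \<rightarrow>\<^sub>E A. c ` V = A \<and> (\<forall>u\<in>V. \<forall>v\<in>V. {u, v} \<in> E \<longrightarrow> c u \<noteq> c v)}
       = card {c \<in> V \<rightarrow>\<^sub>E B. c ` V = B \<and> (\<forall>u\<in>V. \<forall>v\<in>V. {u, v} \<in> E \<longrightarrow> c u \<noteq> c v)}"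
    (is "card (?N A) = card (?N B)")
proof -
  have maps: "restrict (h \<circ> c) V \<in> ?N B" if "bij_betw h A B" "c \<in> ?N A" for h and A B :: "nat set" and c
  proof -
    have c: "c \<in> V \<rightarrow>\<^sub>E A" "c ` V = A" "\<And>u v. u \<in> V \<Longrightarrow> v \<in> V \<Longrightarrow> {u, v} \<in> E \<Longrightarrow> c u \<noteq> c v"
      using that(2) by auto
    have inj: "inj_on h A" and img: "h ` A = B" using that(1) by (auto simp: bij_betw_def)
    have 1: "restrict (h \<circ> c) V ` V = B" using c(2) img by (metis image_comp image_restrict_eq)
    moreover have "restrict (h \<circ> c) V \<in> V \<rightarrow>\<^sub>E B" using c img by auto
    moreover have "h (c u) \<noteq> h (c v)" if "u \<in> V" "v \<in> V" "{u, v} \<in> E" for u v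
      using inj_onD[OF inj, of "c u" "c v"] c that by auto
    ultimately show ?thesis by auto
  qed
  have inverse: "restrict (h' \<circ> restrict (h \<circ> c) V) V = c"
    if "\<And>a. a \<in> A \<Longrightarrow> h' (h a) = a" "c \<in> ?N A" for h h' :: "nat \<Rightarrow> nat" and c A
    using that by (auto simp: fun_eq_iff restrict_def PiE_def extensional_def Pi_def)
  have "bij_betw (\<lambda>c. restrict (h \<circ> c) V) (?N A) (?N B)"
  proof (rule bij_betwI[where g = "\<lambda>c. restrict (the_inv_into A h \<circ> c) V"])
    show "(\<lambda>c. restrict (h \<circ> c) V) \<in> ?N A \<rightarrow> ?N B" using maps[OF assms] by blast
    show "(\<lambda>c. restrict (the_inv_into A h \<circ> c) V) \<in> ?N B \<rightarrow> ?N A"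
      using maps[OF bij_betw_the_inv_into[OF assms]] by blast
    show "restrict (the_inv_into A h \<circ> restrict (h \<circ> c) V) V = c" if "c \<in> ?N A" for c
      using inverse[OF _ that] assms by (simp add: bij_betw_def the_inv_into_f_f)
    show "restrict (h \<circ> restrict (the_inv_into A h \<circ> c) V) V = c" if "c \<in> ?N B" for c
      using inverse[OF _ that] assms by (simp add: bij_betw_def f_the_inv_into_f)
  qed
  then show ?thesis by (rule bij_betw_same_card)
qed

lemma ex1_chromatic_polynomial:
  assumes "finite (fst G)"
  shows "\<exists>!p :: rat poly. \<forall>n::nat. poly p (of_nat n) = of_nat (card (proper_colorings G n))"
proof (rule ex_ex1I)
  obtain V E where G: "G = (V, E)" by (cases G)
  have fin: "finite V" using assms G by simp
  define N where "N A = {c \<in> V \<rightarrow>\<^sub>E A. c ` V = A \<and>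
    (\<forall>u\<in>V. \<forall>v\<in>V. {u, v} \<in> E \<longrightarrow> c u \<noteq> c v)}" for A :: "nat set"
  define a where "a j = card (N {1..j})" for j :: nat
  have N_card: "card (N A) = a (card A)" if A: "finite A" for A
  proof -
    obtain h where "bij_betw h A {1..card A}"
      using finite_same_card_bij[OF A, of "{1..card A}"] by auto
    then show ?thesis unfolding N_def a_def by (rule surjective_proper_colorings_card_eq)
  qed
  have a_0: "a j = 0" if "card V < j" for j
  proof -
    have "N {1..j} = {}"
    proof (rule ccontr)
      assume "N {1..j} \<noteq> {}"
      then obtain c where "c ` V = {1..j}" by (auto simp: N_def)
      then have "j \<le> card V" using card_image_le[OF fin, of c] by simp
      then show False using that by simp
    qed
    then show ?thesis by (simp add: a_def)
  qed
  have count: "card (proper_colorings G n) = (\<Sum>j\<le>card V. a j * (n choose j))" for n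
  proof -
    have "proper_colorings G n = (\<Union>A\<in>Pow {1..n}. N A)"
      by (auto simp: proper_colorings_def N_def G PiE_def Pi_def)
    also have "card \<dots> = (\<Sum>A\<in>Pow {1..n}. card (N A))"
    proof (rule card_UN_disjoint)
      show "\<forall>A\<in>Pow {1..n}. finite (N A)"
      proof
        fix A :: "nat set" assume "A \<in> Pow {1..n}"
        then have "finite A" by (auto intro: finite_subset)
        then have "finite (V \<rightarrow>\<^sub>E A)" by (intro finite_PiE fin)
        then show "finite (N A)" by (simp add: N_def)
      qed
    qed (auto simp: N_def)
    also have "\<dots> = (\<Sum>A\<in>Pow {1..n}. a (card A))"
      by (intro sum.cong refl N_card) (auto intro: finite_subset)
    also have "\<dots> = (\<Sum>j\<le>n. \<Sum>A\<in>{A \<in> Pow {1..n}. card A = j}. a (card A))"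
      by (rule sum.group[symmetric]) (auto dest: card_mono[rotated])
    also have "\<dots> = (\<Sum>j\<le>n. a j * (n choose j))"
      by (intro sum.cong refl) (simp add: Pow_def n_subsets)
    also have "\<dots> = (\<Sum>j\<le>max n (card V). a j * (n choose j))"
      by (rule sum.mono_neutral_left) auto
    also have "\<dots> = (\<Sum>j\<le>card V. a j * (n choose j))"
      by (rule sum.mono_neutral_right) (auto simp: a_0)
    finally show ?thesis .
  qed
  show "\<exists>p :: rat poly. \<forall>n::nat. poly p (of_nat n) = of_nat (card (proper_colorings G n))"
    by (rule exI[of _ "\<Sum>j\<le>card V. smult (of_nat (a j)) (binomial_poly j)"])
      (simp add: count poly_sum poly_binomial_poly_of_nat)
next
  fix p p' :: "rat poly"
  assume p: "\<forall>n::nat. poly p (of_nat n) = of_nat (card (proper_colorings G n))"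
    and p': "\<forall>n::nat. poly p' (of_nat n) = of_nat (card (proper_colorings G n))"
  have "range (of_nat :: nat \<Rightarrow> rat) \<subseteq> {x. poly (p - p') x = 0}" using p p' by auto
  then have "\<not> finite {x. poly (p - p') x = 0}"
    by (metis finite_imageD finite_subset infinite_UNIV_nat inj_of_nat)
  then show "p = p'" using poly_roots_finite[of "p - p'"] by auto
qed

lemma poly_chromatic_polynomial:
  assumes "finite (fst G)"
  shows "poly (chromatic_polynomial G) (of_nat n) = of_nat (card (proper_colorings G n))"
  using theI'[OF ex1_chromatic_polynomial[OF assms]] unfolding chromatic_polynomial_def by blast

lemma finite_kneser_graph: "finite (fst (kneser_graph q k))"
  by (simp add: kneser_graph_def Let_def)

end

theory Submission
  imports Defs
begin

text \<open>By inclusion and exclusion over the violated edges, the chromatic polynomial of a graph with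
  \<open>v\<close> vertices and edge set \<open>E\<close> is the sum of \<open>(- 1) ^ card F * n ^ (v - edge_rank F)\<close> over
  all \<open>F \<subseteq> E\<close>, where the rank is \<open>v\<close> minus the number of components of \<open>F\<close>
  (\<open>chromatic_polynomial_expansion\<close>). Only the empty set of edges has rank \<open>0\<close>, so the
  degree is \<open>v\<close>, and the coefficient at distance \<open>r\<close> below the top is the signed number of
  edge sets of rank \<open>r\<close>.

  In a Kneser graph, sort these edge sets \<open>F\<close> by the set \<open>U\<close> of all points that occur in
  the end points of the edges in \<open>F\<close>. What an edge set looks like, and in particular its rank,
  does not depend on \<open>q\<close> once \<open>U\<close> is given, and by symmetry the signed number belonging
  to \<open>U\<close> depends only on \<open>j = card U\<close> (\<open>signed_count_cong\<close>). There are
  \<open>q choose j\<close> choices of \<open>U\<close>, hence the coefficient is a linear combination of the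
  numbers \<open>q choose j\<close> with weights independent of \<open>q\<close>. It is a polynomial in \<open>q\<close>
  because only finitely many \<open>j\<close> contribute: an edge set of rank \<open>r\<close> covers at most
  \<open>2 * r\<close> vertices (\<open>card_covered_le_rank\<close>), and so at most \<open>2 * r * k\<close> points.

  The depth is infinite because this holds for every \<open>r\<close>. For \<open>r\<close> greater than the degree
  there are no edge sets of rank \<open>r\<close>, so the polynomial in \<open>q\<close> takes the value \<open>0\<close>
  there, as the definition of depth demands.\<close>

section \<open>Components and rank of an edge set\<close>

definition adjacency :: "'v set set \<Rightarrow> 'v rel" where
  "adjacency F = {(u, v). \<exists>e\<in>F. u \<in> e \<and> v \<in> e}"

definition component :: "'v set set \<Rightarrow> 'v \<Rightarrow> 'v set" where
  "component F u = (adjacency F)\<^sup>* `` {u}"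

text \<open>The rank refers only to the vertices covered by \<open>F\<close>, not to an ambient vertex set. In a
  graph on \<open>V\<close> with edge set \<open>F\<close>, every vertex outside \<open>\<Union>F\<close> is a component by
  itself, so this is also \<open>card V\<close> minus the number of all components.\<close>

definition edge_rank :: "'v set set \<Rightarrow> nat" where
  "edge_rank F = card (\<Union>F) - card (component F ` \<Union>F)"

lemma self_in_component [simp]: "u \<in> component F u"
  by (simp add: component_def)

lemma component_eqI:
  assumes "v \<in> component F u"
  shows "component F v = component F u"
proof -
  have "sym ((adjacency F)\<^sup>*)"
    by (rule sym_rtrancl) (auto simp: sym_def adjacency_def)
  then show ?thesis
    using assms unfolding component_def
    by (auto dest: symD intro: rtrancl_trans)
qed

lemma component_edge:
  assumes "e \<in> F" "u \<in> e" "v \<in> e"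
  shows "component F u = component F v"
  using assms by (intro component_eqI) (auto simp: component_def adjacency_def)

lemma component_subset: "u \<in> \<Union>F \<Longrightarrow> component F u \<subseteq> \<Union>F"
  unfolding component_def by (auto elim: rtranclE simp: adjacency_def)

lemma component_isolated: "u \<notin> \<Union>F \<Longrightarrow> component F u = {u}"
  unfolding component_def by (auto elim: converse_rtranclE simp: adjacency_def)

lemma card_components:
  assumes "finite V" "F \<subseteq> Pow V"
  shows "card (component F ` V) = card V - edge_rank F" "edge_rank F \<le> card V"
proof -
  have T: "\<Union>F \<subseteq> V" "finite (\<Union>F)" using assms by (auto intro: finite_subset)
  have "card (component F ` V) = card (component F ` \<Union>F \<union> component F ` (V - \<Union>F))"
    using T(1) by (metis Un_Diff_cancel image_Un sup.absorb2)
  also have "\<dots> = card (component F ` \<Union>F) + card (component F ` (V - \<Union>F))"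
  proof (rule card_Un_disjoint)
    show "component F ` \<Union>F \<inter> component F ` (V - \<Union>F) = {}"
      using component_subset[of _ F] self_in_component[of _ F] by blast
  qed (use T assms in auto)
  also have "component F ` (V - \<Union>F) = (\<lambda>u. {u}) ` (V - \<Union>F)"
    by (rule image_cong) (simp_all add: component_isolated)
  also have "card \<dots> = card V - card (\<Union>F)"
    using T by (simp add: card_image card_Diff_subset)
  finally have "card (component F ` V) = card (component F ` \<Union>F) + (card V - card (\<Union>F))" .
  moreover have "card (component F ` \<Union>F) \<le> card (\<Union>F)" by (rule card_image_le[OF T(2)])
  moreover have "card (\<Union>F) \<le> card V" by (rule card_mono[OF assms(1) T(1)])
  ultimately show "card (component F ` V) = card V - edge_rank F" "edge_rank F \<le> card V"
    by (auto simp: edge_rank_def)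
qed

text \<open>Each component of \<open>\<Union>F\<close> contains an edge and hence two vertices, so there are at
  most half as many components as covered vertices. Thus sets of given rank cover boundedly many
  vertices.\<close>

lemma card_covered_le_rank:
  assumes "finite (\<Union>F)" "\<And>e. e \<in> F \<Longrightarrow> card e = 2"
  shows "card (\<Union>F) \<le> 2 * edge_rank F"
proof -
  let ?C = "component F ` \<Union>F"
  have big: "2 \<le> card X" if X: "X \<in> ?C" for X
  proof -
    obtain u e where u: "X = component F u" "u \<in> e" "e \<in> F" using X by blast
    have "e \<subseteq> X" using component_edge[OF u(3,2)] u(1) self_in_component[of _ F] by blast
    moreover have "finite X" using u component_subset[of u F] assms(1) by (auto intro: finite_subset)
    ultimately show ?thesis using card_mono[of X e] assms(2)[OF u(3)] by simp
  qed
  have "pairwise disjnt ?C"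
    unfolding pairwise_def disjnt_def using component_eqI[of _ F] by blast
  moreover have "finite X" if "X \<in> ?C" for X using big[OF that] by (metis card.infinite not_numeral_le_zero)
  ultimately have "card (\<Union>?C) = sum card ?C" by (rule card_Union_disjoint)
  moreover have "\<Union>?C = \<Union>F" using component_subset[of _ F] self_in_component[of _ F] by blast
  moreover have "2 * card ?C \<le> sum card ?C"
    using sum_mono[of ?C "\<lambda>_. 2" card] big by simp
  ultimately show ?thesis by (simp add: edge_rank_def)
qed

text \<open>A walk in the image lifts back edge by edge: injectivity forces the next edge to start at the
  vertex already reached.\<close>

lemma image_component:
  assumes g: "inj_on g (\<Union>F)" and u: "u \<in> \<Union>F"
  shows "component ((`) g ` F) (g u) = g ` component F u"
proof
  show "g ` component F u \<subseteq> component ((`) g ` F) (g u)"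
  proof
    fix w assume "w \<in> g ` component F u"
    then obtain v where v: "(u, v) \<in> (adjacency F)\<^sup>*" "w = g v" by (auto simp: component_def)
    from v(1) have "(g u, g v) \<in> (adjacency ((`) g ` F))\<^sup>*"
    proof induction
      case (step y z)
      have "(g y, g z) \<in> adjacency ((`) g ` F)" using step(2) by (auto simp: adjacency_def)
      then show ?case using step(3) by (rule rtrancl_into_rtrancl[rotated])
    qed simp
    then show "w \<in> component ((`) g ` F) (g u)" by (simp add: component_def v(2))
  qed
  show "component ((`) g ` F) (g u) \<subseteq> g ` component F u"
  proof
    fix w assume "w \<in> component ((`) g ` F) (g u)"
    then have "(g u, w) \<in> (adjacency ((`) g ` F))\<^sup>*" by (simp add: component_def)
    then show "w \<in> g ` component F u"
    proof induction
      case (step y z)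
      obtain v where v: "y = g v" "v \<in> component F u" using step(3) by auto
      obtain e x where e: "e \<in> F" "y \<in> g ` e" "x \<in> e" "z = g x"
        using step(2) by (auto simp: adjacency_def)
      have "v \<in> \<Union>F" using v(2) component_subset[OF u] by auto
      then have "v \<in> e" using e(1,2) v(1) inj_onD[OF g] by blast
      then have "component F x = component F u"
        using component_edge[OF e(1,3)] component_eqI[OF v(2)] by blast
      then show ?case using e(4) self_in_component[of x F] by blast
    qed simp
  qed
qed

lemma edge_rank_image:
  assumes "inj_on g (\<Union>F)"
  shows "edge_rank ((`) g ` F) = edge_rank F"
proof -
  have U: "\<Union>((`) g ` F) = g ` \<Union>F" by auto
  have "component ((`) g ` F) ` \<Union>((`) g ` F) = (`) g ` (component F ` \<Union>F)"
    unfolding U image_image by (rule image_cong[OF refl image_component[OF assms]])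
  moreover have "inj_on ((`) g) (component F ` \<Union>F)"
    by (rule inj_on_subset[OF inj_on_image_Pow[OF assms]]) (use component_subset[of _ F] in blast)
  ultimately show ?thesis unfolding edge_rank_def U by (simp add: card_image assms)
qed

section \<open>Expansion of the chromatic polynomial over edge sets\<close>

definition monochromatic :: "('v \<Rightarrow> 'c) \<Rightarrow> 'v set \<Rightarrow> bool" where
  "monochromatic c e \<longleftrightarrow> (\<forall>u\<in>e. \<forall>v\<in>e. c u = c v)"

text \<open>A function that is constant on every edge of \<open>F\<close> is a free choice of one value for each component.\<close>

lemma card_monochromatic_functions:
  assumes "finite V" "F \<subseteq> Pow V"
  shows "card {c \<in> V \<rightarrow>\<^sub>E B. \<forall>e\<in>F. monochromatic c e} = card B ^ (card V - edge_rank F)"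
proof -
  let ?D = "component F ` V"
  have mem: "component F u \<subseteq> V" if "u \<in> V" for u
  proof (cases "u \<in> \<Union>F")
    case True
    then show ?thesis using component_subset[of u F] assms(2) by blast
  next
    case False
    then show ?thesis using component_isolated[of u F] that by simp
  qed
  have "bij_betw (\<lambda>d. \<lambda>u\<in>V. d (component F u)) (?D \<rightarrow>\<^sub>E B)
          {c \<in> V \<rightarrow>\<^sub>E B. \<forall>e\<in>F. monochromatic c e}"
  proof (rule bij_betwI[where g = "\<lambda>c. \<lambda>X\<in>?D. c (SOME v. v \<in> X)"])
    show "(\<lambda>d. \<lambda>u\<in>V. d (component F u)) \<in>
      (?D \<rightarrow>\<^sub>E B) \<rightarrow> {c \<in> V \<rightarrow>\<^sub>E B. \<forall>e\<in>F. monochromatic c e}"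
    proof
      fix d assume d: "d \<in> ?D \<rightarrow>\<^sub>E B"
      let ?c = "\<lambda>u\<in>V. d (component F u)"
      have "?c u = ?c v" if e: "e \<in> F" "u \<in> e" "v \<in> e" for e u v
      proof -
        have "u \<in> V" "v \<in> V" using e assms(2) by blast+
        then show ?thesis using component_edge[OF e] by simp
      qed
      then have "\<forall>e\<in>F. monochromatic ?c e" unfolding monochromatic_def by blast
      moreover have "?c \<in> V \<rightarrow>\<^sub>E B" using d by auto
      ultimately show "?c \<in> {c \<in> V \<rightarrow>\<^sub>E B. \<forall>e\<in>F. monochromatic c e}" by blast
    qed
    have some: "(SOME v. v \<in> X) \<in> X" if X: "X \<in> ?D" for X
    proof -
      obtain u where "X = component F u" using X by blast
      then have "u \<in> X" by simp
      then show ?thesis by (rule someI)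
    qed
    show "(\<lambda>c. \<lambda>X\<in>?D. c (SOME v. v \<in> X)) \<in>
      {c \<in> V \<rightarrow>\<^sub>E B. \<forall>e\<in>F. monochromatic c e} \<rightarrow> (?D \<rightarrow>\<^sub>E B)"
    proof
      fix c assume "c \<in> {c \<in> V \<rightarrow>\<^sub>E B. \<forall>e\<in>F. monochromatic c e}"
      then have c: "c \<in> V \<rightarrow>\<^sub>E B" by simp
      have "c (SOME v. v \<in> X) \<in> B" if X: "X \<in> ?D" for X
      proof -
        have "X \<subseteq> V" using X mem by blast
        then show ?thesis using some[OF X] c by (meson PiE_mem subsetD)
      qed
      then show "(\<lambda>X\<in>?D. c (SOME v. v \<in> X)) \<in> ?D \<rightarrow>\<^sub>E B" by auto
    qed
    show "(\<lambda>X\<in>?D. (\<lambda>u\<in>V. d (component F u)) (SOME v. v \<in> X)) = d" if d: "d \<in> ?D \<rightarrow>\<^sub>E B" for d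
    proof (rule ext)
      fix X
      show "(\<lambda>X\<in>?D. (\<lambda>u\<in>V. d (component F u)) (SOME v. v \<in> X)) X = d X"
      proof (cases "X \<in> ?D")
        case True
        then obtain u where u: "u \<in> V" "X = component F u" by auto
        have "component F (SOME v. v \<in> X) = X"
          using component_eqI[of "SOME v. v \<in> X" F u] some[OF True] unfolding u(2) .
        moreover have "(SOME v. v \<in> X) \<in> V" using some[OF True] mem[OF u(1)] u(2) by blast
        ultimately show ?thesis using True by simp
      next
        case False
        then show ?thesis using d by (auto simp: PiE_def extensional_def)
      qed
    qed
    show "(\<lambda>u\<in>V. (\<lambda>X\<in>?D. c (SOME v. v \<in> X)) (component F u)) = c"
      if c: "c \<in> {c \<in> V \<rightarrow>\<^sub>E B. \<forall>e\<in>F. monochromatic c e}" for c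
    proof (rule ext)
      fix u
      have const: "c v = c u" if "v \<in> component F u" for v
      proof -
        have "(u, v) \<in> (adjacency F)\<^sup>*" using that by (simp add: component_def)
        then show ?thesis
        proof induction
          case (step y z)
          obtain e where "e \<in> F" "y \<in> e" "z \<in> e" using step(2) by (auto simp: adjacency_def)
          then have "c y = c z" using c unfolding monochromatic_def by blast
          then show ?case using step(3) by simp
        qed simp
      qed
      show "(\<lambda>u\<in>V. (\<lambda>X\<in>?D. c (SOME v. v \<in> X)) (component F u)) u = c u"
      proof (cases "u \<in> V")
        case True
        then show ?thesis using const[OF some[of "component F u"]] by simp
      next
        case False
        then show ?thesis using c by (auto simp: PiE_def extensional_def)
      qed
    qed
  qed
  then have "card {c \<in> V \<rightarrow>\<^sub>E B. \<forall>e\<in>F. monochromatic c e} = card (?D \<rightarrow>\<^sub>E B)"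
    by (rule bij_betw_same_card[symmetric])
  also have "\<dots> = card B ^ card ?D" using assms(1) by (simp add: card_PiE)
  also have "\<dots> = card B ^ (card V - edge_rank F)" by (simp only: card_components(1)[OF assms])
  finally show ?thesis .
qed

lemma sum_Pow_minus_one:
  assumes "finite A"
  shows "(\<Sum>F\<in>Pow A. (- 1) ^ card F) = (if A = {} then 1 else 0 :: 'a :: comm_ring_1)"
  using prod_add[OF assms, of "\<lambda>_. - 1 :: 'a" "\<lambda>_. 1"] assms by (auto simp: power_0_left card_eq_0_iff)

text \<open>Inclusion and exclusion over the set of edges that a colouring violates.\<close>

lemma card_colorings_expansion:
  assumes "finite V" "E \<subseteq> Pow V" "finite B"
  shows "of_nat (card {c \<in> V \<rightarrow>\<^sub>E B. \<forall>e\<in>E. \<not> monochromatic c e}) =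
    (\<Sum>F\<in>Pow E. (- 1) ^ card F * of_nat (card B) ^ (card V - edge_rank F) :: 'a :: comm_ring_1)"
proof -
  have fE: "finite E" using assms by (auto intro: finite_subset)
  have fC: "finite (V \<rightarrow>\<^sub>E B)" by (rule finite_PiE) (use assms in auto)
  have "(of_nat (card {c \<in> V \<rightarrow>\<^sub>E B. \<forall>e\<in>E. \<not> monochromatic c e}) :: 'a) =
      (\<Sum>c \<in> V \<rightarrow>\<^sub>E B. if \<forall>e\<in>E. \<not> monochromatic c e then 1 else 0)"
    using fC by (simp add: sum.If_cases Int_def)
  also have "\<dots> = (\<Sum>c \<in> V \<rightarrow>\<^sub>E B. \<Sum>F\<in>Pow {e \<in> E. monochromatic c e}. (- 1) ^ card F)"
    by (rule sum.cong[OF refl], subst sum_Pow_minus_one) (use fE in auto)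
  also have "\<dots> = (\<Sum>c \<in> V \<rightarrow>\<^sub>E B. \<Sum>F | F \<in> Pow E \<and> (\<forall>e\<in>F. monochromatic c e). (- 1) ^ card F)"
    by (intro sum.cong) auto
  also have "\<dots> = (\<Sum>F\<in>Pow E. \<Sum>c | c \<in> V \<rightarrow>\<^sub>E B \<and> (\<forall>e\<in>F. monochromatic c e). (- 1) ^ card F)"
    by (rule sum.swap_restrict) (use fC fE in auto)
  also have "\<dots> = (\<Sum>F\<in>Pow E. (- 1) ^ card F * of_nat (card B) ^ (card V - edge_rank F))"
  proof (rule sum.cong[OF refl])
    fix F assume "F \<in> Pow E"
    then have "F \<subseteq> Pow V" using assms(2) by auto
    from card_monochromatic_functions[OF assms(1) this, of B]
    show "(\<Sum>c | c \<in> V \<rightarrow>\<^sub>E B \<and> (\<forall>e\<in>F. monochromatic c e). (- 1) ^ card F) =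
        ((- 1) ^ card F * of_nat (card B) ^ (card V - edge_rank F) :: 'a)"
      by (simp add: mult.commute)
  qed
  finally show ?thesis .
qed

lemma chromatic_polynomial_expansion:
  assumes V: "finite V" and E: "E \<subseteq> Pow V" and two: "\<And>e. e \<in> E \<Longrightarrow> card e = 2"
  shows "chromatic_polynomial (V, E) = (\<Sum>F\<in>Pow E. monom ((- 1) ^ card F) (card V - edge_rank F))"
    (is "_ = ?p")
proof -
  have "poly ?p (of_nat n) = of_nat (card (proper_colorings (V, E) n))" for n
  proof -
    have "(\<forall>u\<in>V. \<forall>v\<in>V. {u, v} \<in> E \<longrightarrow> c u \<noteq> c v) \<longleftrightarrow> (\<forall>e\<in>E. \<not> monochromatic c e)" for c :: "'a \<Rightarrow> nat"
    proof
      assume *: "\<forall>u\<in>V. \<forall>v\<in>V. {u, v} \<in> E \<longrightarrow> c u \<noteq> c v"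
      show "\<forall>e\<in>E. \<not> monochromatic c e"
      proof
        fix e assume e: "e \<in> E"
        obtain u v where uv: "e = {u, v}" using two[OF e] by (auto simp: card_2_iff)
        then have "c u \<noteq> c v" using * e E by blast
        then show "\<not> monochromatic c e" by (auto simp: uv monochromatic_def)
      qed
    qed (fastforce simp: monochromatic_def)
    then have "proper_colorings (V, E) n = {c \<in> V \<rightarrow>\<^sub>E {1..n}. \<forall>e\<in>E. \<not> monochromatic c e}"
      unfolding proper_colorings_def by simp
    then show ?thesis
      using card_colorings_expansion[OF V E, of "{1..n}", where 'a = rat]
      by (simp add: poly_sum poly_monom)
  qed
  then show ?thesis
    using ex1_chromatic_polynomial[of "(V, E)"] poly_chromatic_polynomial[of "(V, E)"] V
    by (metis fst_conv)
qed

text \<open>The summands of the expansion have degree at most \<open>card V\<close>, with equality only for the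
  empty edge set. In the third claim both sides are \<open>0\<close> for \<open>r > card V\<close>, because no edge
  set has such a rank.\<close>

lemma chromatic_polynomial_coeffs:
  assumes V: "finite V" and E: "E \<subseteq> Pow V" and two: "\<And>e. e \<in> E \<Longrightarrow> card e = 2"
  defines "p \<equiv> chromatic_polynomial (V, E)"
  shows "p \<noteq> 0" "degree p = card V"
    "(if r \<le> card V then coeff p (card V - r) else 0) =
      (\<Sum>F | F \<subseteq> E \<and> edge_rank F = r. (- 1) ^ card F)"
proof -
  have fE: "finite E" using V E by (auto intro: finite_subset)
  have le: "edge_rank F \<le> card V" if "F \<subseteq> E" for F
    using card_components(2)[OF V, of F] that E by auto
  have p: "p = (\<Sum>F\<in>Pow E. monom ((- 1) ^ card F) (card V - edge_rank F))"
    unfolding p_def by (rule chromatic_polynomial_expansion[OF V E two])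
  have coeff: "coeff p (card V - r) = (\<Sum>F | F \<subseteq> E \<and> edge_rank F = r. (- 1) ^ card F)"
    if r: "r \<le> card V" for r
  proof -
    have "coeff p (card V - r) = (\<Sum>F\<in>Pow E. if edge_rank F = r then (- 1) ^ card F else 0)"
      unfolding p coeff_sum
    proof (rule sum.cong[OF refl])
      fix F assume "F \<in> Pow E"
      then have "edge_rank F \<le> card V" using le by auto
      then show "coeff (monom ((- 1) ^ card F) (card V - edge_rank F)) (card V - r) =
          (if edge_rank F = r then (- 1) ^ card F else 0 :: rat)"
        using r by auto
    qed
    then show ?thesis using fE by (simp add: sum.If_cases Int_def)
  qed
  \<comment> \<open>Rank \<open>0\<close> means that no vertex is covered, which leaves only the empty edge set.\<close>
  have "{F. F \<subseteq> E \<and> edge_rank F = 0} = {{}}"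
  proof -
    have "F = {}" if F: "F \<subseteq> E" "edge_rank F = 0" for F
    proof -
      have fin: "finite (\<Union>F)" using F E V by (blast intro: finite_subset)
      then have "\<Union>F = {}" using card_covered_le_rank[OF fin] F two by auto
      moreover have "{} \<notin> F" using two F by force
      ultimately show ?thesis by auto
    qed
    then show ?thesis by (auto simp: edge_rank_def)
  qed
  then have lead: "coeff p (card V) = 1" using coeff[of 0] by simp
  then show "p \<noteq> 0" by auto
  have "degree p \<le> card V"
    unfolding p by (rule degree_sum_le) (use fE in \<open>auto intro: order.trans[OF degree_monom_le]\<close>)
  moreover have "card V \<le> degree p" using lead by (intro le_degree) simp
  ultimately show "degree p = card V" by simp
  have no_F: "{F. F \<subseteq> E \<and> edge_rank F = r} = {}" if "\<not> r \<le> card V" using le that by auto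
  then show "(if r \<le> card V then coeff p (card V - r) else 0) =
      (\<Sum>F | F \<subseteq> E \<and> edge_rank F = r. (- 1) ^ card F)"
  proof (cases "r \<le> card V")
    case True
    then show ?thesis using coeff by simp
  next
    case False
    show ?thesis unfolding no_F[OF False] using False by simp
  qed
qed

section \<open>Edge sets of Kneser graphs\<close>

text \<open>There is no ground set here, so that one family contains the edges of all Kneser graphs with
  parameter \<open>k\<close>.\<close>

definition kneser_edges :: "nat \<Rightarrow> 'a set set set" where
  "kneser_edges k = {{A, B} | A B. card A = k \<and> card B = k \<and> A \<inter> B = {}}"

text \<open>The condition on \<open>U\<close> is an equality: these families are pairwise disjoint for
  different \<open>U\<close>, and their union over \<open>U \<subseteq> {1..q}\<close> consists of the edge sets of rank
  \<open>r\<close> in \<open>kneser_graph q k\<close>.\<close>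

definition spanning_edge_sets :: "nat \<Rightarrow> nat \<Rightarrow> 'a set \<Rightarrow> 'a set set set set" where
  "spanning_edge_sets k r U = {F. F \<subseteq> kneser_edges k \<and> \<Union>(\<Union>F) = U \<and> edge_rank F = r}"

definition signed_count :: "nat \<Rightarrow> nat \<Rightarrow> 'a set \<Rightarrow> rat" where
  "signed_count k r U = (\<Sum>F\<in>spanning_edge_sets k r U. (- 1) ^ card F)"

text \<open>For \<open>k = 0\<close> the empty set would be disjoint from itself and form a loop.\<close>

lemma card_kneser_edge:
  assumes "k \<ge> 1" "e \<in> kneser_edges k"
  shows "card e = 2"
proof -
  obtain A B where e: "e = {A, B}" "card A = k" "A \<inter> B = {}"
    using assms(2) by (auto simp: kneser_edges_def)
  then have "A \<noteq> B" using assms(1) by auto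
  then show ?thesis by (simp add: e)
qed

lemma card_kneser_vertex: "e \<in> kneser_edges k \<Longrightarrow> A \<in> e \<Longrightarrow> card A = k"
  by (auto simp: kneser_edges_def)

lemma kneser_graph_eq:
  "kneser_graph q k =
    ({A. A \<subseteq> {1..q} \<and> card A = k}, {e \<in> kneser_edges k. \<Union>e \<subseteq> {1..q}})"
  unfolding kneser_graph_def kneser_edges_def Let_def by auto

lemma finite_spanning_edge_sets: "finite U \<Longrightarrow> finite (spanning_edge_sets k r U)"
  by (rule finite_subset[of _ "Pow (Pow (Pow U))"]) (auto simp: spanning_edge_sets_def)

text \<open>An edge set of rank \<open>r\<close> covers at most \<open>2 * r\<close> vertices, each with \<open>k\<close> points.\<close>

lemma card_le_of_spanning:
  assumes "k \<ge> 1" "finite U" "F \<in> spanning_edge_sets k r U"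
  shows "card U \<le> 2 * r * k"
proof -
  have F: "F \<subseteq> kneser_edges k" "\<Union>(\<Union>F) = U" "edge_rank F = r"
    using assms(3) by (auto simp: spanning_edge_sets_def)
  have "\<Union>F \<subseteq> Pow U" using F(2) by blast
  then have fin: "finite (\<Union>F)" using assms(2) by (simp add: finite_subset)
  have "card U \<le> (\<Sum>A\<in>\<Union>F. card A)"
    using card_Union_le_sum_card[of "\<Union>F"] F(2) by simp
  also have "\<dots> = (\<Sum>A\<in>\<Union>F. k)"
    by (rule sum.cong[OF refl]) (use F(1) card_kneser_vertex in blast)
  also have "\<dots> \<le> 2 * r * k"
    using card_covered_le_rank[OF fin] card_kneser_edge[OF assms(1)] F by auto
  finally show ?thesis .
qed

lemma image_spanning_edge_sets:
  assumes h: "bij_betw h U W" and F: "F \<in> spanning_edge_sets k r U"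
  shows "(`) ((`) h) ` F \<in> spanning_edge_sets k r W"
proof -
  have F': "F \<subseteq> kneser_edges k" "\<Union>(\<Union>F) = U" "edge_rank F = r"
    using F by (auto simp: spanning_edge_sets_def)
  have inj: "inj_on h U" and img: "h ` U = W" using h by (auto simp: bij_betw_def)
  have "(`) ((`) h) ` F \<subseteq> kneser_edges k"
  proof (rule image_subsetI)
    fix e assume e: "e \<in> F"
    then obtain A B where AB: "e = {A, B}" "card A = k" "card B = k" "A \<inter> B = {}"
      using F'(1) by (auto simp: kneser_edges_def)
    have sub: "A \<subseteq> U" "B \<subseteq> U" using AB(1) e F'(2) by auto
    have "card (h ` A) = k" "card (h ` B) = k"
      using AB sub inj by (auto simp: card_image inj_on_subset)
    moreover have "h ` A \<inter> h ` B = {}"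
      using inj_on_image_Int[OF inj sub] AB(4) by simp
    ultimately show "(`) h ` e \<in> kneser_edges k" unfolding kneser_edges_def AB(1) by blast
  qed
  moreover have "\<Union>(\<Union>((`) ((`) h) ` F)) = W" using F'(2) img by blast
  moreover have "edge_rank ((`) ((`) h) ` F) = r"
    using edge_rank_image[of "(`) h" F] inj_on_subset[OF inj_on_image_Pow[OF inj]] F'(2,3) by blast
  ultimately show ?thesis by (simp add: spanning_edge_sets_def)
qed

lemma image_edge_sets_cancel:
  assumes "\<And>x. x \<in> \<Union>(\<Union>F) \<Longrightarrow> g (h x) = x"
  shows "(`) ((`) g) ` ((`) ((`) h) ` F) = F"
proof -
  have A: "g ` h ` A = A" if "e \<in> F" "A \<in> e" for A e
    using assms that unfolding image_image by (subst image_cong[of A A _ "\<lambda>x. x"]) auto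
  have e: "(`) g ` ((`) h ` e) = e" if "e \<in> F" for e
    using A[OF that] unfolding image_image[of "(`) g"] by (subst image_cong[of e e _ "\<lambda>x. x"]) auto
  show ?thesis
    using e unfolding image_image[of "(`) ((`) g)"] by (subst image_cong[of F F _ "\<lambda>x. x"]) auto
qed

text \<open>Relabelling the points preserves every ingredient, so only the size of the set matters.\<close>

lemma signed_count_cong:
  assumes h: "bij_betw h U W"
  shows "signed_count k r U = signed_count k r W"
proof -
  define g where "g = the_inv_into U h"
  have g: "bij_betw g W U" unfolding g_def by (rule bij_betw_the_inv_into[OF h])
  have inj: "inj_on h U" and img: "h ` U = W" using h by (auto simp: bij_betw_def)
  have gh: "g (h x) = x" if "x \<in> U" for x unfolding g_def by (rule the_inv_into_f_f[OF inj that])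
  have hg: "h (g y) = y" if "y \<in> W" for y
    unfolding g_def by (rule f_the_inv_into_f[OF inj]) (simp add: that img)
  show ?thesis
    unfolding signed_count_def
  proof (rule sum.reindex_bij_witness[where i = "\<lambda>F. (`) ((`) g) ` F" and j = "\<lambda>F. (`) ((`) h) ` F"])
    fix F assume F: "F \<in> spanning_edge_sets k r U"
    then have U: "\<Union>(\<Union>F) = U" by (simp add: spanning_edge_sets_def)
    show "(`) ((`) g) ` ((`) ((`) h) ` F) = F" by (rule image_edge_sets_cancel) (simp add: U gh)
    show "(`) ((`) h) ` F \<in> spanning_edge_sets k r W" by (rule image_spanning_edge_sets[OF h F])
    have "inj_on ((`) ((`) h)) (Pow (Pow U))" by (intro inj_on_image_Pow inj)
    moreover have "F \<subseteq> Pow (Pow U)" using U by blast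
    ultimately have "card ((`) ((`) h) ` F) = card F" by (metis card_image inj_on_subset)
    then show "(- 1) ^ card ((`) ((`) h) ` F) = (- 1 :: rat) ^ card F" by simp
  next
    fix F assume F: "F \<in> spanning_edge_sets k r W"
    then have W: "\<Union>(\<Union>F) = W" by (simp add: spanning_edge_sets_def)
    show "(`) ((`) h) ` ((`) ((`) g) ` F) = F" by (rule image_edge_sets_cancel) (simp add: W hg)
    show "(`) ((`) g) ` F \<in> spanning_edge_sets k r U" by (rule image_spanning_edge_sets[OF g F])
  qed
qed

section \<open>Coefficients as polynomials in the size of the ground set\<close>

definition rank_coeff_poly :: "nat \<Rightarrow> nat \<Rightarrow> rat poly" where
  "rank_coeff_poly k r =
    (\<Sum>j\<le>2 * r * k. smult (signed_count k r {1..j}) (binomial_poly j))"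

text \<open>Sorting by the set \<open>U\<close> of points used turns the sum into the sum over \<open>j\<close> of
  \<open>q choose j\<close> times the signed count for \<open>{1..j}\<close>. Its natural range is
  \<open>j \<le> q\<close>; it can be replaced by the range \<open>j \<le> 2 * r * k\<close>, which is independent of
  \<open>q\<close>, because beyond \<open>q\<close> the binomial coefficients vanish and beyond
  \<open>2 * r * k\<close> the signed counts do.\<close>

lemma sum_kneser_edge_sets:
  assumes k: "k \<ge> 1"
  shows "(\<Sum>F | F \<subseteq> {e \<in> kneser_edges k. \<Union>e \<subseteq> {1..q}} \<and> edge_rank F = r. (- 1) ^ card F)
    = poly (rank_coeff_poly k r) (of_nat q)"
proof -
  let ?w = "\<lambda>j. signed_count k r {1..j}"
  have w_0: "?w j = 0" if "j > 2 * r * k" for j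
  proof -
    have "spanning_edge_sets k r {1..j} = {}"
      using card_le_of_spanning[OF k, of "{1..j}" _ r] that by fastforce
    then show ?thesis by (simp add: signed_count_def)
  qed
  have "{F. F \<subseteq> {e \<in> kneser_edges k. \<Union>e \<subseteq> {1..q}} \<and> edge_rank F = r}
      = (\<Union>U\<in>Pow {1..q}. spanning_edge_sets k r U)"
    by (auto simp: spanning_edge_sets_def; blast)
  then have "(\<Sum>F | F \<subseteq> {e \<in> kneser_edges k. \<Union>e \<subseteq> {1..q}} \<and> edge_rank F = r. (- 1) ^ card F)
      = (\<Sum>F \<in> (\<Union>U\<in>Pow {1..q}. spanning_edge_sets k r U). (- 1 :: rat) ^ card F)" by simp
  also have "\<dots> = (\<Sum>U\<in>Pow {1..q}. signed_count k r U)"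
    unfolding signed_count_def
  proof (rule sum.UNION_disjoint)
    show "\<forall>U\<in>Pow {1..q}. finite (spanning_edge_sets k r U)"
      by (auto intro!: finite_spanning_edge_sets intro: finite_subset)
  qed (auto simp: spanning_edge_sets_def)
  also have "\<dots> = (\<Sum>U\<in>Pow {1..q}. ?w (card U))"
  proof (rule sum.cong[OF refl])
    fix U assume "U \<in> Pow {1..q}"
    then have "finite U" by (auto intro: finite_subset)
    then obtain h where "bij_betw h U {1..card U}"
      using finite_same_card_bij[of U "{1..card U}"] by auto
    then show "signed_count k r U = ?w (card U)" by (rule signed_count_cong)
  qed
  also have "\<dots> = (\<Sum>j\<le>q. \<Sum>U\<in>{U \<in> Pow {1..q}. card U = j}. ?w (card U))"
    by (rule sum.group[symmetric]) (auto dest: card_mono[rotated])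
  also have "\<dots> = (\<Sum>j\<le>q. ?w j * of_nat (q choose j))"
    by (intro sum.cong refl) (simp add: Pow_def n_subsets mult.commute)
  also have "\<dots> = (\<Sum>j\<le>max q (2 * r * k). ?w j * of_nat (q choose j))"
    by (rule sum.mono_neutral_left) auto
  also have "\<dots> = (\<Sum>j\<le>2 * r * k. ?w j * of_nat (q choose j))"
    by (rule sum.mono_neutral_right) (auto simp: w_0 simp del: One_nat_def)
  finally show ?thesis
    by (simp add: rank_coeff_poly_def poly_sum poly_binomial_poly_of_nat)
qed

lemma numerical_polynomial_binomial_poly: "numerical_polynomial (binomial_poly k)"
  unfolding numerical_polynomial_def poly_binomial_poly
proof
  fix q :: int
  show "(of_int q :: rat) gchoose k \<in> \<int>"
  proof (cases "q \<ge> 0")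
    case True
    then have "(of_int q :: rat) = of_nat (nat q)" by simp
    then show ?thesis by (metis Ints_of_nat binomial_gbinomial)
  next
    case False
    then have "of_nat k - (of_int q :: rat) - 1 = of_nat (k + nat (- q) - 1)"
      by simp
    then have "(of_int q :: rat) gchoose k = (- 1) ^ k * of_nat ((k + nat (- q) - 1) choose k)"
      by (metis binomial_gbinomial gbinomial_negated_upper)
    then show ?thesis by simp
  qed
qed

theorem theorem29:
  fixes k :: nat
  assumes "k \<ge> 1"
  shows "two_level_polynomial (binomial_poly k) (\<lambda>q. Pinf)
           (\<lambda>q. chromatic_polynomial (kneser_graph q k))"
proof -
  let ?f = "\<lambda>q. chromatic_polynomial (kneser_graph q k)"
  have f: "?f q \<noteq> 0" "degree (?f q) = q choose k"
    "(if r \<le> q choose k then coeff (?f q) ((q choose k) - r) else 0) =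
      poly (rank_coeff_poly k r) (of_nat q)" for q r
  proof -
    let ?V = "{A. A \<subseteq> {1..q} \<and> card A = k}" and ?E = "{e \<in> kneser_edges k. \<Union>e \<subseteq> {1..q}}"
    have V: "finite ?V" "card ?V = q choose k" by (simp_all add: n_subsets)
    have E: "?E \<subseteq> Pow ?V" using card_kneser_vertex by blast
    have two: "card e = 2" if "e \<in> ?E" for e using card_kneser_edge[OF assms] that by blast
    note coeffs = chromatic_polynomial_coeffs[OF V(1) E two, folded kneser_graph_eq, unfolded V(2)]
    show "?f q \<noteq> 0" "degree (?f q) = q choose k"
      "(if r \<le> q choose k then coeff (?f q) ((q choose k) - r) else 0) =
        poly (rank_coeff_poly k r) (of_nat q)"
      using coeffs sum_kneser_edge_sets[OF assms] by auto
  qed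
  show ?thesis
    unfolding two_level_polynomial_def Let_def poly_binomial_poly_of_nat f(2)
    by (simp add: numerical_polynomial_binomial_poly f(1) split del: if_split)
      (use f(3) in blast)
qed

end
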